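(* Let $n\ge 5$. For each $i\in\{1,2,3\}$, the $n\times n$ sign pattern $\mathcal{A}_i$ allows $\mathbb{H}_n$, i.e. $\mathbb{H}_n\subseteq\{\mathrm{ri}(B)\mid B\in Q(\mathcal{A}_i)\}$, where $\mathbb{H}_n=\{(0,n,0,0),(0,n-2,0,2),(2,n-2,0,0)\}$.
   Context: The refined inertia of a real square matrix $B$ is $\mathrm{ri}(B)=(n_+(B),n_-(B),n_z(B),2n_p(B))$, where $n_+$ (resp. $n_-$) is the number of eigenvalues (with multiplicity) with positive (resp. negative) real part, $n_z$ is the number of zero eigenvalues, and $2n_p$ is the number of nonzero pure imaginary eigenvalues. A sign pattern is a matrix with entries in $\{+,-,0\}$; for an $n\times n$ sign pattern $\mathcal{A}$, $Q(\mathcal{A})$ is the set of real $n\times n$ matrices whose entrywise signs equal $\mathcal{A}$. The $n\times n$ sign patterns ($n\ge 4$) are defined as follows; in all three, every off-diagonal entry not in the first row or first column is $0$, and the $(2,2)$ entry is $0$. $\mathcal{A}_1$: $(1,1)$ entry $+$, entries $(1,j)$ for $j\ge2$ are $+$, entries $(j,1)$ for $j\ge 2$ are $-$, diagonal entries $(j,j)$ for $3\le j\le n$ are $-$. $\mathcal{A}_2$: $(1,1)$ entry $-$, entries $(1,j)$ for $j\ge 2$ are $+$, $(2,1)$ entry $-$, entries $(j,1)$ for $3\le j\le n$ are $+$, diagonal entries $(j,j)$ for $3\le j\le n$ are $-$. $\mathcal{A}_3$: $(1,1)$ entry $-$, entries $(1,j)$ for $j\ge2$ are $+$, entries $(j,1)$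 for $2\le j\le n-1$ are $+$, $(n,1)$ entry $-$, diagonal entries $(j,j)$ for $3\le j\le n-1$ are $-$, and $(n,n)$ entry $+$. *)

theory Defs
  imports "Jordan_Normal_Form.Char_Poly"
    "HOL-Computational_Algebra.Fundamental_Theorem_Algebra"
begin

text \<open>Complex eigenvalues of a real square matrix, repeated according to algebraic multiplicity.\<close>

definition eigenvalue_mset :: "real mat \<Rightarrow> complex multiset" where
  "eigenvalue_mset B = proots (char_poly (map_mat complex_of_real B))"

text \<open>The last component is the quantity written \<open>2n\<^sub>p\<close>: it is the number of nonzero purely
  imaginary eigenvalues itself, not twice that number.\<close>

definition refined_inertia :: "real mat \<Rightarrow> nat \<times> nat \<times> nat \<times> nat" where
  "refined_inertia B =
     (size {# z \<in># eigenvalue_mset B. Re z > 0 #},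
      size {# z \<in># eigenvalue_mset B. Re z < 0 #},
      size {# z \<in># eigenvalue_mset B. z = 0 #},
      size {# z \<in># eigenvalue_mset B. Re z = 0 \<and> z \<noteq> 0 #})"

definition HH :: "nat \<Rightarrow> (nat \<times> nat \<times> nat \<times> nat) set" where
  "HH n = {(0, n, 0, 0), (0, n - 2, 0, 2), (2, n - 2, 0, 0)}"

datatype sign = Pos | Neg | Zero

definition sign_of :: "real \<Rightarrow> sign" where
  "sign_of x = (if x > 0 then Pos else if x < 0 then Neg else Zero)"

definition Q :: "sign mat \<Rightarrow> real mat set" where
  "Q A = {B \<in> carrier_mat (dim_row A) (dim_col A).
            \<forall>i < dim_row A. \<forall>j < dim_col A. sign_of (B $$ (i, j)) = A $$ (i, j)}"

definition allows :: "sign mat \<Rightarrow> (nat \<times> nat \<times> nat \<times> nat) set \<Rightarrow> bool" where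
  "allows A S \<longleftrightarrow> S \<subseteq> {refined_inertia B | B. B \<in> Q A}"

text \<open>Matrix indices start at 0 in the library; the entry function \<open>f\<close> below is indexed from 1.\<close>

definition sign_pattern :: "nat \<Rightarrow> (nat \<Rightarrow> nat \<Rightarrow> sign) \<Rightarrow> sign mat" where
  "sign_pattern n f = mat n n (\<lambda>(i, j). f (i + 1) (j + 1))"

definition pattern_A1 :: "nat \<Rightarrow> sign mat" where
  "pattern_A1 n = sign_pattern n (\<lambda>i j.
     if i = 1 then Pos
     else if j = 1 then Neg
     else if i = j \<and> 3 \<le> i then Neg
     else Zero)"

definition pattern_A2 :: "nat \<Rightarrow> sign mat" where
  "pattern_A2 n = sign_pattern n (\<lambda>i j.
     if i = 1 then (if j = 1 then Neg else Pos)
     else if j = 1 then (if i = 2 then Neg else Pos)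
     else if i = j \<and> 3 \<le> i then Neg
     else Zero)"

definition pattern_A3 :: "nat \<Rightarrow> sign mat" where
  "pattern_A3 n = sign_pattern n (\<lambda>i j.
     if i = 1 then (if j = 1 then Neg else Pos)
     else if j = 1 then (if i = n then Neg else Pos)
     else if i = j \<and> 3 \<le> i then (if i = n then Pos else Neg)
     else Zero)"

end

theory Submission
  imports Defs
begin

text \<open>The idea is to prescribe the diagonal entries \<open>d\<^sub>k\<close> (distinct) and the whole spectrum of an
  arrow matrix: \<open>n - 2\<close> distinct negative reals \<open>r\<^sub>i\<close> and the pair \<open>\<sigma> \<plusminus> \<i>\<close> with
  \<open>\<sigma> \<in> {-1, 0, 1}\<close>, which yields the three refined inertias of \<open>HH n\<close>. The first column is
  then forced by the partial fraction expansion of the prescribed characteristic polynomial divided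
  by \<open>\<Prod>k. x - d\<^sub>k\<close>. Its signs depend only on how the \<open>r\<^sub>i\<close> and the \<open>d\<^sub>k\<close> interlace,
  since \<open>(x - \<sigma>)\<^sup>2 + 1\<close> is positive, and each pattern corresponds to one way of interlacing. The
  \<open>n\<close> prescribed values are distinct and have explicit eigenvectors, so they are all the
  eigenvalues and no determinant has to be expanded.\<close>

section \<open>Partial fractions of a quotient of monic products\<close>

lemma coeff_prod_monic_linear:
  fixes \<rho> :: "'i \<Rightarrow> 'a::comm_ring_1"
  assumes "finite I"
  shows "coeff (\<Prod>i\<in>I. [:- \<rho> i, 1:]) (card I) = 1"
    and "card I = Suc N \<Longrightarrow> coeff (\<Prod>i\<in>I. [:- \<rho> i, 1:]) N = - sum \<rho> I"
    and "degree (\<Prod>i\<in>I. [:- \<rho> i, 1:]) \<le> card I"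
  using assms
proof (induction I arbitrary: N rule: finite_induct)
  case empty
  { case 1 then show ?case by simp }
  { case 2 then show ?case by simp }
  { case 3 then show ?case by simp }
next
  case (insert x F)
  { case 1
    have "coeff (\<Prod>i\<in>F. [:- \<rho> i, 1:]) (Suc (card F)) = 0"
      using insert.IH(3) by (intro coeff_eq_0) simp
    then show ?case using insert by simp }
  { case 2
    then have N: "N = card F" using insert by simp
    show ?case
    proof (cases N)
      case 0
      then show ?thesis using insert N by simp
    next
      case (Suc M)
      then show ?thesis using insert.IH(1) insert.IH(2)[of M] insert.hyps N by simp
    qed }
  { case 3
    have "degree ([:- \<rho> x, 1:] * (\<Prod>i\<in>F. [:- \<rho> i, 1:])) \<le> 1 + card F"
      by (rule order_trans[OF degree_mult_le add_mono]) (use insert.IH(3) in auto)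
    then show ?case using insert by simp }
qed

lemma poly_prod_linear:
  "poly (\<Prod>i\<in>I. [:- \<rho> i, 1:]) x = (\<Prod>i\<in>I. x - \<rho> i)" for x :: "'a::comm_ring_1"
  by (simp add: poly_prod)

text \<open>Lagrange interpolation: after clearing denominators, the difference \<open>f\<close> of
  the two sides vanishes at the \<open>card K\<close> distinct points \<open>d k\<close>, while all
  its coefficients from index \<open>card K\<close> upwards cancel, so it is zero. The
  second-highest coefficient forces the constant subtracted from \<open>x\<close>.\<close>

lemma prod_quotient_partial_fractions:
  fixes \<rho> :: "'i \<Rightarrow> 'a::field" and d :: "'k \<Rightarrow> 'a"
  assumes fin: "finite I" "finite K" and card: "card I = Suc (card K)"
    and inj: "inj_on d K" and x: "x \<notin> d ` K"
  shows "(\<Prod>i\<in>I. x - \<rho> i) / (\<Prod>k\<in>K. x - d k) =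
    x - (sum \<rho> I - sum d K)
      + (\<Sum>k\<in>K. (\<Prod>i\<in>I. d k - \<rho> i) / (\<Prod>l\<in>K - {k}. d k - d l) / (x - d k))"
proof -
  define c where "c k = (\<Prod>i\<in>I. d k - \<rho> i) / (\<Prod>l\<in>K - {k}. d k - d l)" for k
  define a where "a = sum \<rho> I - sum d K"
  define P where "P = (\<Prod>i\<in>I. [:- \<rho> i, 1:])"
  define q where "q = (\<Prod>k\<in>K. [:- d k, 1:])"
  define S where "S = (\<Sum>k\<in>K. Polynomial.smult (c k) (\<Prod>l\<in>K - {k}. [:- d l, 1:]))"
  define f where "f = P - [:- a, 1:] * q - S"
  \<comment> \<open>At a node, every summand of \<open>S\<close> except the node's own contains a
    vanishing factor.\<close>
  have off: "(\<Prod>l\<in>K - {k}. d k' - d l) = 0" if "k' \<in> K" "k' \<noteq> k" for k k'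
    using that fin by (intro prod_zero) auto
  have diag: "(\<Prod>l\<in>K - {k}. d k - d l) \<noteq> 0" if "k \<in> K" for k
    using that fin inj by (auto simp: inj_on_def)
  have root: "poly f (d k) = 0" if k: "k \<in> K" for k
  proof -
    have "poly S (d k) = (\<Sum>k'\<in>K. c k' * (\<Prod>l\<in>K - {k'}. d k - d l))"
      by (simp add: S_def poly_sum poly_prod_linear)
    also have "\<dots> = (\<Sum>k'\<in>K. if k' = k then c k * (\<Prod>l\<in>K - {k}. d k - d l) else 0)"
      using off k by (intro sum.cong) auto
    also have "\<dots> = (\<Prod>i\<in>I. d k - \<rho> i)"
      using fin k diag[OF k] by (simp add: c_def)
    finally have "poly S (d k) = poly P (d k)" by (simp add: P_def poly_prod_linear)
    moreover have "poly q (d k) = 0"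
      using k fin by (simp add: q_def poly_prod_linear) blast
    ultimately show ?thesis by (simp add: f_def)
  qed
  have "f = 0"
  proof (rule ccontr)
    assume "f \<noteq> 0"
    have "card K = card (d ` K)" using inj by (simp add: card_image)
    also have "\<dots> \<le> card {y. poly f y = 0}"
      using root \<open>f \<noteq> 0\<close> by (intro card_mono poly_roots_finite) auto
    also have "\<dots> \<le> degree f" using \<open>f \<noteq> 0\<close> by (rule card_poly_roots_bound)
    finally have deg_ge: "card K \<le> degree f" .
    have degS: "degree S \<le> card K - 1"
      unfolding S_def
    proof (rule degree_sum_le[OF fin(2)])
      fix k assume "k \<in> K"
      have "degree (\<Prod>l\<in>K - {k}. [:- d l, 1:]) \<le> card (K - {k})"
        using fin by (intro coeff_prod_monic_linear(3)) auto
      then show "degree (Polynomial.smult (c k) (\<Prod>l\<in>K - {k}. [:- d l, 1:])) \<le> card K - 1"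
        using degree_smult_le[of "c k" "\<Prod>l\<in>K - {k}. [:- d l, 1:]"] \<open>k \<in> K\<close> fin by simp
    qed
    \<comment> \<open>For empty \<open>K\<close> the truncated bound \<open>card K - 1\<close> is 0
      and would still permit a constant term, but then \<open>S\<close> is an empty sum.\<close>
    have cS: "coeff S n = 0" if "n \<ge> card K" for n
    proof (cases "K = {}")
      case True then show ?thesis by (simp add: S_def)
    next
      case False
      then have "card K > 0" using fin by (simp add: card_gt_0_iff)
      then show ?thesis using degS that by (intro coeff_eq_0) linarith
    qed
    have cP: "coeff P (Suc (card K)) = 1" "coeff P (card K) = - sum \<rho> I" "degree P \<le> Suc (card K)"
      using coeff_prod_monic_linear[OF fin(1), where \<rho> = \<rho>] card unfolding P_def by auto
    have dq: "degree q \<le> card K" and cq: "coeff q (card K) = 1"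
      using coeff_prod_monic_linear[OF fin(2), where \<rho> = d] unfolding q_def by auto
    \<comment> \<open>\<open>pCons 0 q\<close> is X times \<open>q\<close>, so this is the
      coefficient of \<open>q\<close> just below its top one. Together with \<open>- a\<close> it
      gives the coefficient of \<open>[:- a, 1:] * q\<close> that has to match
      \<open>- sum \<rho> I\<close>.\<close>
    have c0: "coeff (pCons 0 q) (card K) = - sum d K"
    proof (cases "card K")
      case 0 then show ?thesis using fin by simp
    next
      case (Suc N)
      then show ?thesis
        using coeff_prod_monic_linear(2)[OF fin(2) Suc, where \<rho> = d] by (simp add: q_def)
    qed
    have "coeff f n = 0" if n: "n \<ge> card K" for n
    proof -
      consider "n = card K" | "n = Suc (card K)" | "n > Suc (card K)" using n by linarith
      then show ?thesis
      proof cases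
        case 1
        then show ?thesis using cP cq c0 cS by (simp add: f_def a_def)
      next
        case 2
        moreover have "coeff q (Suc (card K)) = 0" using dq by (intro coeff_eq_0) simp
        ultimately show ?thesis using cP cq cS by (simp add: f_def)
      next
        case 3
        then obtain M where M: "n = Suc M" "M > card K" by (cases n) auto
        have "coeff q n = 0" "coeff q M = 0" "coeff P n = 0"
          using dq cP(3) 3 M by (auto intro!: coeff_eq_0)
        then show ?thesis using cS n M by (simp add: f_def)
      qed
    qed
    then show False using deg_ge \<open>f \<noteq> 0\<close> leading_coeff_neq_0 by blast
  qed
  then have "P = [:- a, 1:] * q + S" unfolding f_def diff_diff_eq by simp
  then have "poly P x = poly ([:- a, 1:] * q + S) x" by (rule arg_cong)
  then have eq: "(\<Prod>i\<in>I. x - \<rho> i) = (x - a) * (\<Prod>k\<in>K. x - d k)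
      + (\<Sum>k\<in>K. c k * (\<Prod>l\<in>K - {k}. x - d l))"
    by (simp add: P_def q_def S_def poly_sum poly_prod_linear algebra_simps)
  have ne: "(\<Prod>k\<in>K. x - d k) \<noteq> 0" using x fin by auto
  have "(\<Sum>k\<in>K. c k * (\<Prod>l\<in>K - {k}. x - d l)) / (\<Prod>k\<in>K. x - d k) = (\<Sum>k\<in>K. c k / (x - d k))"
    unfolding sum_divide_distrib
  proof (rule sum.cong[OF refl])
    fix k assume k: "k \<in> K"
    have "(\<Prod>l\<in>K - {k}. x - d l) \<noteq> 0" "x - d k \<noteq> 0" using x fin k by auto
    then show "c k * (\<Prod>l\<in>K - {k}. x - d l) / (\<Prod>k\<in>K. x - d k) = c k / (x - d k)"
      by (subst prod.remove[OF fin(2) k]) simp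
  qed
  then show ?thesis
    using ne unfolding eq by (simp add: add_divide_distrib a_def c_def)
qed

section \<open>Arrow matrices with prescribed spectrum\<close>

definition arrow_mat :: "nat \<Rightarrow> 'a::field \<Rightarrow> (nat \<Rightarrow> 'a) \<Rightarrow> (nat \<Rightarrow> 'a) \<Rightarrow> 'a mat" where
  "arrow_mat n a w d = mat n n (\<lambda>(i, j).
     if i = 0 then (if j = 0 then a else 1)
     else if j = 0 then w (i - 1)
     else if i = j then d (i - 1)
     else 0)"

text \<open>With first coordinate 1, the lower rows of the eigenvector equation force the
  coordinates \<open>w k / (\<mu> - d k)\<close>; the first row then becomes the secular equation
  \<open>sec\<close>.\<close>

lemma eigenvalue_arrow_mat:
  assumes ne: "\<And>k. k < m \<Longrightarrow> \<mu> \<noteq> d k"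
    and sec: "\<mu> - a = (\<Sum>k<m. w k / (\<mu> - d k))"
  shows "eigenvalue (arrow_mat (Suc m) a w d) \<mu>"
  unfolding eigenvalue_def eigenvector_def
proof (intro exI conjI)
  define v where "v = vec (Suc m) (\<lambda>i. if i = 0 then 1 else w (i - 1) / (\<mu> - d (i - 1)))"
  show "v \<in> carrier_vec (dim_row (arrow_mat (Suc m) a w d))"
    by (simp add: v_def arrow_mat_def)
  show "v \<noteq> 0\<^sub>v (dim_row (arrow_mat (Suc m) a w d))"
  proof
    assume "v = 0\<^sub>v (dim_row (arrow_mat (Suc m) a w d))"
    then have "v $ 0 = 0\<^sub>v (Suc m) $ 0" by (simp add: arrow_mat_def)
    then show False by (simp add: v_def)
  qed
  show "arrow_mat (Suc m) a w d *\<^sub>v v = \<mu> \<cdot>\<^sub>v v"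
  proof (rule eq_vecI)
    fix i assume "i < dim_vec (\<mu> \<cdot>\<^sub>v v)"
    then have i: "i < Suc m" by (simp add: v_def)
    have "(arrow_mat (Suc m) a w d *\<^sub>v v) $ i =
        (\<Sum>j<Suc m. arrow_mat (Suc m) a w d $$ (i, j) * v $ j)"
      using i by (simp add: arrow_mat_def v_def scalar_prod_def atLeast0LessThan)
    also have "\<dots> = arrow_mat (Suc m) a w d $$ (i, 0)
        + (\<Sum>k<m. arrow_mat (Suc m) a w d $$ (i, Suc k) * (w k / (\<mu> - d k)))"
      by (simp add: sum.lessThan_Suc_shift v_def del: sum.lessThan_Suc)
    also have "\<dots> = \<mu> * v $ i"
    proof (cases i)
      case 0
      then show ?thesis using sec by (simp add: arrow_mat_def v_def algebra_simps)
    next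
      case (Suc l)
      then have l: "l < m" using i by simp
      have "(\<Sum>k<m. arrow_mat (Suc m) a w d $$ (i, Suc k) * (w k / (\<mu> - d k)))
          = (\<Sum>k<m. if k = l then d l * (w l / (\<mu> - d l)) else 0)"
        using Suc l by (intro sum.cong) (auto simp: arrow_mat_def)
      moreover have "w l + d l * (w l / (\<mu> - d l)) = \<mu> * (w l / (\<mu> - d l))"
        using ne[OF l] by (simp add: field_simps)
      ultimately show ?thesis using Suc l by (simp add: arrow_mat_def v_def)
    qed
    finally show "(arrow_mat (Suc m) a w d *\<^sub>v v) $ i = (\<mu> \<cdot>\<^sub>v v) $ i"
      using i by (simp add: v_def)
  qed (simp add: arrow_mat_def v_def)
qed

text \<open>Each member of \<open>L\<close> is a root of multiplicity at least 1, and the degree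
  \<open>n\<close> leaves no room for other roots or higher multiplicities.\<close>

lemma proots_char_poly_eqI:
  fixes A :: "'a::field mat"
  assumes A: "A \<in> carrier_mat n n" and card: "card L = n" and fin: "finite L"
    and eig: "\<And>\<mu>. \<mu> \<in> L \<Longrightarrow> eigenvalue A \<mu>"
  shows "proots (char_poly A) = mset_set L"
proof -
  have nz: "char_poly A \<noteq> 0" and deg: "degree (char_poly A) = n"
    using degree_monic_char_poly[OF A] by auto
  have sub: "mset_set L \<subseteq># proots (char_poly A)"
  proof (rule mset_subset_eqI)
    fix \<mu> show "count (mset_set L) \<mu> \<le> count (proots (char_poly A)) \<mu>"
    proof (cases "\<mu> \<in> L")
      case True
      then have "poly (char_poly A) \<mu> = 0"
        using eigenvalue_root_char_poly[OF A] eig by blast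
      then have "order \<mu> (char_poly A) > 0" using nz by (simp add: order_gt_0_iff)
      then show ?thesis using True fin nz by simp
    qed simp
  qed
  have "size (proots (char_poly A)) \<le> size (mset_set L)"
    using size_proots_le[of "char_poly A"] deg card by simp
  then show ?thesis
    using sub by (metis mset_subset_size subset_mset.le_less leD)
qed

text \<open>The choice of \<open>a\<close> and \<open>w\<close> makes x - a - sum of w_k / (x - d_k)
  the partial fraction expansion of the prescribed characteristic polynomial over the product of the
  x - d_k. The value of \<open>a\<close> is the trace condition, and (x - \<sigma>)^2 + 1 is the
  factor of the conjugate pair.\<close>

lemma refined_inertia_arrow_mat:
  fixes r d :: "nat \<Rightarrow> real"
  assumes injr: "inj_on r {..<m}" and neg: "\<And>i. i < m \<Longrightarrow> r i < 0"
    and injd: "inj_on d {..m}" and disj: "\<And>i k. i < m \<Longrightarrow> k \<le> m \<Longrightarrow> r i \<noteq> d k"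
    and a: "a = (\<Sum>i<m. r i) + 2 * \<sigma> - (\<Sum>k\<le>m. d k)"
    and w: "\<And>k. k \<le> m \<Longrightarrow> w k = - (((d k - \<sigma>)\<^sup>2 + 1) * (\<Prod>i<m. d k - r i)
              / (\<Prod>l\<in>{..m} - {k}. d k - d l))"
  shows "refined_inertia (arrow_mat (m + 2) a w d) =
    (if \<sigma> > 0 then 2 else 0, if \<sigma> < 0 then m + 2 else m, 0, if \<sigma> = 0 then 2 else 0)"
proof -
  \<comment> \<open>Indices \<open>m\<close> and \<open>m + 1\<close> carry the conjugate pair. The
    \<open>m + 2\<close> values are one more than the \<open>m + 1\<close> entries
    \<open>d k\<close>, as the expansion requires.\<close>
  define \<rho> where "\<rho> i = (if i < m then complex_of_real (r i)
      else if i = m then Complex \<sigma> 1 else Complex \<sigma> (- 1))" for i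
  let ?d = "\<lambda>k. complex_of_real (d k)" and ?w = "\<lambda>k. complex_of_real (w k)"
  let ?C = "arrow_mat (m + 2) (complex_of_real a) ?w ?d"
  have map: "map_mat complex_of_real (arrow_mat (m + 2) a w d) = ?C"
    by (rule eq_matI) (auto simp: arrow_mat_def)
  have split: "{..<m + 2} = {..<m} \<union> {m, Suc m}" by auto
  have ext: "\<rho> m = Complex \<sigma> 1" "\<rho> (Suc m) = Complex \<sigma> (- 1)" by (auto simp: \<rho>_def)
  \<comment> \<open>Imaginary parts 0, 1 and -1 keep the pair apart from the reals, even if \<sigma>
    equals some \<open>r i\<close>.\<close>
  have injrho: "inj_on \<rho> {..<m + 2}"
    using injr by (auto simp: inj_on_def \<rho>_def complex_eq_iff)
  have sumrho: "(\<Sum>i<m + 2. \<rho> i) = complex_of_real ((\<Sum>i<m. r i) + 2 * \<sigma>)"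
  proof -
    have "(\<Sum>i<m. \<rho> i) = (\<Sum>i<m. complex_of_real (r i))" by (simp add: \<rho>_def)
    then show ?thesis using ext by (simp add: complex_eq_iff)
  qed
  have prodrho: "(\<Prod>i<m + 2. complex_of_real x - \<rho> i)
      = complex_of_real (((x - \<sigma>)\<^sup>2 + 1) * (\<Prod>i<m. x - r i))" for x
  proof -
    have "(\<Prod>i<m. complex_of_real x - \<rho> i) = (\<Prod>i<m. complex_of_real x - complex_of_real (r i))"
      by (simp add: \<rho>_def)
    moreover have "(complex_of_real x - Complex \<sigma> 1) * (complex_of_real x - Complex \<sigma> (- 1))
        = complex_of_real ((x - \<sigma>)\<^sup>2 + 1)"
      by (simp add: complex_eq_iff power2_eq_square)
    ultimately show ?thesis using ext by (simp add: mult_ac)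
  qed
  have eig: "eigenvalue ?C \<mu>" if "\<mu> \<in> \<rho> ` {..<m + 2}" for \<mu>
  proof -
    from that obtain i where i: "i < m + 2" "\<mu> = \<rho> i" by auto
    have ne: "\<mu> \<noteq> ?d k" if "k \<le> m" for k
      using disj[OF _ that, of i] i by (auto simp: \<rho>_def complex_eq_iff)
    have "(\<Prod>i<m + 2. \<mu> - \<rho> i) / (\<Prod>k\<le>m. \<mu> - ?d k) =
        \<mu> - (sum \<rho> {..<m + 2} - sum ?d {..m})
        + (\<Sum>k\<le>m. (\<Prod>i<m + 2. ?d k - \<rho> i) / (\<Prod>l\<in>{..m} - {k}. ?d k - ?d l) / (\<mu> - ?d k))"
      using injd ne by (intro prod_quotient_partial_fractions) (auto simp: inj_on_def)
    \<comment> \<open>The vanishing left-hand side turns the expansion at \<mu> into the secular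
      equation.\<close>
    moreover have "(\<Prod>i<m + 2. \<mu> - \<rho> i) = 0"
      using i by (intro prod_zero) auto
    moreover have "(\<Sum>k\<le>m. (\<Prod>i<m + 2. ?d k - \<rho> i) / (\<Prod>l\<in>{..m} - {k}. ?d k - ?d l) / (\<mu> - ?d k))
        = - (\<Sum>k\<le>m. ?w k / (\<mu> - ?d k))"
      unfolding sum_negf[symmetric] prodrho by (intro sum.cong) (auto simp: w)
    moreover have "sum \<rho> {..<m + 2} - sum ?d {..m} = complex_of_real a"
      unfolding sumrho a by simp
    ultimately have "\<mu> - complex_of_real a = (\<Sum>k<Suc m. ?w k / (\<mu> - ?d k))"
      by (simp only: lessThan_Suc_atMost) (simp add: algebra_simps)
    then show ?thesis
      using eigenvalue_arrow_mat[of "Suc m" \<mu> ?d] ne by (simp add: less_Suc_eq_le)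
  qed
  have "eigenvalue_mset (arrow_mat (m + 2) a w d) = mset_set (\<rho> ` {..<m + 2})"
    unfolding eigenvalue_mset_def map
  proof (rule proots_char_poly_eqI[OF _ _ _ eig])
    show "card (\<rho> ` {..<m + 2}) = m + 2" by (simp only: card_image[OF injrho] card_lessThan)
  qed (simp_all add: arrow_mat_def)
  also have "\<dots> = image_mset \<rho> (mset_set {..<m + 2})"
    by (rule image_mset_mset_set[OF injrho, symmetric])
  also have "\<dots> = {#Complex \<sigma> 1, Complex \<sigma> (- 1)#} + image_mset \<rho> (mset_set {..<m})"
    by (simp add: lessThan_Suc ext)
  finally have E: "eigenvalue_mset (arrow_mat (m + 2) a w d)
      = {#Complex \<sigma> 1, Complex \<sigma> (- 1)#} + image_mset \<rho> (mset_set {..<m})" .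
  let ?M = "image_mset \<rho> (mset_set {..<m})"
  have Re: "Re z < 0" if "z \<in># ?M" for z using that neg by (auto simp: \<rho>_def)
  \<comment> \<open>The real eigenvalues contribute to the negative count only, so the other three
    counts come from the pair alone.\<close>
  have none: "filter_mset P ?M = {#}" if "\<And>z. Re z < 0 \<Longrightarrow> \<not> P z" for P
    using that Re by (auto simp: filter_mset_eq_conv)
  have all: "filter_mset (\<lambda>z. Re z < 0) ?M = ?M"
    using Re by (simp add: filter_mset_eq_conv)
  have "filter_mset (\<lambda>z. Re z > 0) ?M = {#}" "filter_mset (\<lambda>z. z = 0) ?M = {#}"
    "filter_mset (\<lambda>z. Re z = 0 \<and> z \<noteq> 0) ?M = {#}"
    by (rule none; auto)+
  then show ?thesis
    unfolding refined_inertia_def E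
    by (simp add: all complex_eq_iff)
qed

section \<open>From interlacing to the signs of the first column\<close>

lemma sgn_prod_diff:
  fixes r :: "'i \<Rightarrow> real"
  assumes "finite I" "\<And>i. i \<in> I \<Longrightarrow> r i \<noteq> x"
  shows "sgn (\<Prod>i\<in>I. x - r i) = (- 1) ^ card {i \<in> I. x < r i}"
  using assms
proof (induction I rule: finite_induct)
  case (insert y F)
  have "{i \<in> insert y F. x < r i} = (if x < r y then insert y {i \<in> F. x < r i} else {i \<in> F. x < r i})"
    by auto
  moreover have "sgn (x - r y) = (if x < r y then - 1 else 1)"
    using insert.prems[of y] by (auto simp: sgn_if)
  ultimately show ?case using insert by (simp add: sgn_mult)
qed simp

lemma sign_of_sgn_if:
  "sgn x = (if P then - 1 else 1) \<Longrightarrow> sign_of x = (if P then Neg else Pos)"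
  by (auto simp: sign_of_def sgn_if split: if_splits)

text \<open>The sign of \<open>w k\<close> is minus the parity sign of the number of
  \<open>r i\<close> and \<open>d l\<close> lying above \<open>d k\<close>, whence the parity test
  in \<open>col\<close>. One choice of \<open>r\<close> and \<open>d\<close> serves all three
  inertias, so \<open>corner\<close> must hold uniformly in \<sigma>.\<close>

lemma allows_HH_if_arrow:
  fixes r d :: "nat \<Rightarrow> real"
  assumes injr: "inj_on r {..<m}" and neg: "\<And>i. i < m \<Longrightarrow> r i < 0"
    and injd: "inj_on d {..m}" and disj: "\<And>i k. i < m \<Longrightarrow> k \<le> m \<Longrightarrow> r i \<noteq> d k"
    and A: "A \<in> carrier_mat (m + 2) (m + 2)"
    and corner: "\<And>\<sigma>. \<bar>\<sigma>\<bar> \<le> 1 \<Longrightarrow>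
      A $$ (0, 0) = sign_of ((\<Sum>i<m. r i) + 2 * \<sigma> - (\<Sum>k\<le>m. d k))"
    and row: "\<And>k. k \<le> m \<Longrightarrow> A $$ (0, Suc k) = Pos"
    and col: "\<And>k. k \<le> m \<Longrightarrow> A $$ (Suc k, 0) =
      (if even (card {i \<in> {..<m}. d k < r i} + card {l \<in> {..m}. d k < d l}) then Neg else Pos)"
    and diag: "\<And>k. k \<le> m \<Longrightarrow> A $$ (Suc k, Suc k) = sign_of (d k)"
    and off: "\<And>k l. k \<le> m \<Longrightarrow> l \<le> m \<Longrightarrow> k \<noteq> l \<Longrightarrow> A $$ (Suc k, Suc l) = Zero"
  shows "allows A (HH (m + 2))"
proof -
  define a where "a \<sigma> = (\<Sum>i<m. r i) + 2 * \<sigma> - (\<Sum>k\<le>m. d k)" for \<sigma>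
  define w where "w \<sigma> k = - (((d k - \<sigma>)\<^sup>2 + 1) * (\<Prod>i<m. d k - r i)
      / (\<Prod>l\<in>{..m} - {k}. d k - d l))" for \<sigma> k
  define B where "B \<sigma> = arrow_mat (m + 2) (a \<sigma>) (w \<sigma>) d" for \<sigma>
  have ri: "refined_inertia (B \<sigma>) =
    (if \<sigma> > 0 then 2 else 0, if \<sigma> < 0 then m + 2 else m, 0, if \<sigma> = 0 then 2 else 0)" for \<sigma>
    unfolding B_def by (rule refined_inertia_arrow_mat[OF injr neg injd disj a_def w_def])
  have w: "sign_of (w \<sigma> k) = A $$ (Suc k, 0)" if k: "k \<le> m" for \<sigma> k
  proof -
    \<comment> \<open>\<sigma> enters \<open>w\<close> through this factor only; its positivity
      makes the column signs independent of \<sigma>.\<close>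
    have pos: "sgn ((d k - \<sigma>)\<^sup>2 + 1) = 1"
      by (rule sgn_pos) (simp add: add_nonneg_pos)
    have num: "sgn (\<Prod>i<m. d k - r i) = (- 1) ^ card {i \<in> {..<m}. d k < r i}"
      using disj k by (intro sgn_prod_diff) auto
    have "sgn (\<Prod>l\<in>{..m} - {k}. d k - d l) = (- 1) ^ card {l \<in> {..m} - {k}. d k < d l}"
      using injd k by (intro sgn_prod_diff) (auto simp: inj_on_def)
    also have "{l \<in> {..m} - {k}. d k < d l} = {l \<in> {..m}. d k < d l}" by auto
    finally have den: "sgn (\<Prod>l\<in>{..m} - {k}. d k - d l) = (- 1) ^ card {l \<in> {..m}. d k < d l}" .
    have "sgn (w \<sigma> k) = - ((- 1) ^ card {i \<in> {..<m}. d k < r i} / (- 1) ^ card {l \<in> {..m}. d k < d l})"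
      unfolding w_def sgn_minus sgn_divide sgn_mult pos num den by simp
    also have "\<dots> = (if even (card {i \<in> {..<m}. d k < r i} + card {l \<in> {..m}. d k < d l})
        then - 1 else 1)"
      by (auto simp: uminus_power_if)
    finally show ?thesis
      unfolding col[OF k] by (rule sign_of_sgn_if)
  qed
  have BQ: "B \<sigma> \<in> Q A" if "\<bar>\<sigma>\<bar> \<le> 1" for \<sigma>
    unfolding Q_def
  proof (intro CollectI conjI allI impI)
    show "B \<sigma> \<in> carrier_mat (dim_row A) (dim_col A)" using A by (simp add: B_def arrow_mat_def)
    fix i j assume "i < dim_row A" "j < dim_col A"
    then have ij: "i < m + 2" "j < m + 2" using A by auto
    then show "sign_of (B \<sigma> $$ (i, j)) = A $$ (i, j)"
      using corner[OF that] w row diag off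
      by (cases i; cases j) (auto simp: B_def arrow_mat_def a_def sign_of_def)
  qed
  have "h \<in> {refined_inertia B | B. B \<in> Q A}" if "h \<in> HH (m + 2)" for h
  proof -
    have "\<exists>\<sigma>. \<bar>\<sigma>\<bar> \<le> 1 \<and> h = refined_inertia (B \<sigma>)"
    proof -
      from that consider "h = (0, m + 2, 0, 0)" | "h = (0, m, 0, 2)" | "h = (2, m, 0, 0)"
        by (auto simp: HH_def)
      then show ?thesis
      proof cases
        case 1 then show ?thesis by (intro exI[of _ "- 1"]) (simp add: ri)
      next
        case 2 then show ?thesis by (intro exI[of _ 0]) (simp add: ri)
      next
        case 3 then show ?thesis by (intro exI[of _ 1]) (simp add: ri)
      qed
    qed
    then show ?thesis using BQ by blast
  qed
  then show ?thesis by (auto simp: allows_def)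
qed

section \<open>Interlacings for the three patterns\<close>

lemma sum_even_numbers: "(\<Sum>i<m. 2 * real i) = real m * real m - real m"
  by (induction m) (auto simp: algebra_simps)

text \<open>Strict alternation from the top: d_0 = 0 > r_0 > d_1 > r_1 > ... > d_m. Above d_k lie
  \<open>k\<close> values of each kind, an even total, so the whole column is negative. The corner
  is m + 2 \<sigma>, positive since m is at least 3.\<close>

lemma allows_A1:
  assumes "m \<ge> 3"
  shows "allows (pattern_A1 (m + 2)) (HH (m + 2))"
proof (rule allows_HH_if_arrow[where r = "\<lambda>i. - 2 * real i - 1" and d = "\<lambda>k. - 2 * real k"])
  fix i k :: nat
  \<comment> \<open>Odd differs from even: decided over the integers, then transferred to the
    reals.\<close>
  have "- 2 * int i - 1 \<noteq> - 2 * int k" by presburger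
  then have "real_of_int (- 2 * int i - 1) \<noteq> real_of_int (- 2 * int k)" by linarith
  then show "- 2 * real i - 1 \<noteq> - 2 * real k" by simp
next
  fix \<sigma> :: real assume "\<bar>\<sigma>\<bar> \<le> 1"
  then have "- 1 \<le> \<sigma>" "\<sigma> \<le> 1" by linarith+
  moreover have "real m \<ge> 3" using assms by simp
  moreover have "(\<Sum>i<m. - 2 * real i - 1) = - (real m * real m)"
    using sum_even_numbers[of m] by (simp add: sum_subtractf sum_negf)
  moreover have "(\<Sum>k\<le>m. - 2 * real k) = - (real m * real m + real m)"
    using sum_even_numbers[of "Suc m"]
    by (simp add: sum_negf lessThan_Suc_atMost[symmetric] algebra_simps)
  ultimately show "pattern_A1 (m + 2) $$ (0, 0) =
      sign_of ((\<Sum>i<m. - 2 * real i - 1) + 2 * \<sigma> - (\<Sum>k\<le>m. - 2 * real k))"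
    by (simp add: pattern_A1_def sign_pattern_def sign_of_def)
next
  fix k assume k: "k \<le> m"
  have 1: "{i \<in> {..<m}. - 2 * real k < - 2 * real i - 1} = {..<k}" using k by auto
  have 2: "{l \<in> {..m}. - 2 * real k < - 2 * real l} = {..<k}" using k by auto
  show "pattern_A1 (m + 2) $$ (Suc k, 0) =
      (if even (card {i \<in> {..<m}. - 2 * real k < - 2 * real i - 1}
        + card {l \<in> {..m}. - 2 * real k < - 2 * real l}) then Neg else Pos)"
    unfolding 1 2 using k by (simp add: pattern_A1_def sign_pattern_def)
qed (auto simp: pattern_A1_def sign_pattern_def sign_of_def inj_on_def)

text \<open>Order d_0 = 0 > d_1 > r_0 > d_2 > r_1 > ... > d_m > r_(m-1). Nothing lies above d_0,
  giving the single negative column entry; above a later d_k lie 2k - 1 values, an odd number. The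
  corner is 2 \<sigma> - m, which is negative.\<close>

lemma allows_A2:
  assumes "m \<ge> 3"
  shows "allows (pattern_A2 (m + 2)) (HH (m + 2))"
proof -
  define d where "d k = (if k = 0 then 0 else 1 - 2 * real k)" for k
  show ?thesis
  proof (rule allows_HH_if_arrow[where r = "\<lambda>i. - 2 * real i - 2" and d = d])
    show "inj_on d {..m}" by (auto simp: inj_on_def d_def)
  next
    fix i k :: nat
    have "- 2 * int i - 2 \<noteq> 1 - 2 * int k" by presburger
    then have "real_of_int (- 2 * int i - 2) \<noteq> real_of_int (1 - 2 * int k)" by linarith
    then show "- 2 * real i - 2 \<noteq> d k" by (simp add: d_def)
  next
    fix \<sigma> :: real assume "\<bar>\<sigma>\<bar> \<le> 1"
    then have "- 1 \<le> \<sigma>" "\<sigma> \<le> 1" by linarith+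
    moreover have "real m \<ge> 3" using assms by simp
    moreover have "(\<Sum>i<m. - 2 * real i - 2) = - (real m * real m + real m)"
      using sum_even_numbers[of m] by (simp add: sum_subtractf sum_negf)
    moreover have "(\<Sum>k\<le>m. d k) = - (real m * real m)"
      using sum_even_numbers[of m]
      by (simp add: d_def lessThan_Suc_atMost[symmetric] sum.lessThan_Suc_shift sum_subtractf
          sum_negf algebra_simps del: sum.lessThan_Suc)
    ultimately show "pattern_A2 (m + 2) $$ (0, 0) =
        sign_of ((\<Sum>i<m. - 2 * real i - 2) + 2 * \<sigma> - (\<Sum>k\<le>m. d k))"
      by (simp add: pattern_A2_def sign_pattern_def sign_of_def)
  next
    fix k assume k: "k \<le> m"
    \<comment> \<open>For k = 0 the truncated \<open>k - 1\<close> correctly yields the empty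
      set.\<close>
    have 1: "{i \<in> {..<m}. d k < - 2 * real i - 2} = {..<k - 1}" using k by (auto simp: d_def)
    have 2: "{l \<in> {..m}. d k < d l} = {..<k}" using k by (auto simp: d_def)
    show "pattern_A2 (m + 2) $$ (Suc k, 0) =
        (if even (card {i \<in> {..<m}. d k < - 2 * real i - 2} + card {l \<in> {..m}. d k < d l})
         then Neg else Pos)"
      unfolding 1 2 using k by (cases k) (simp_all add: pattern_A2_def sign_pattern_def)
  qed (auto simp: pattern_A2_def sign_pattern_def sign_of_def inj_on_def d_def)
qed

text \<open>Order d_m = 1 > d_0 = 0 > r_0 > d_1 > r_1 > ... > d_(m-1) > r_(m-1). The positive entry
  d_m tops everything, so its column entry is negative; it also adds one to the even count 2k above
  every other d_k, making those entries positive. The corner is 2 \<sigma> - 1 - m, which is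
  negative.\<close>

lemma allows_A3:
  assumes "m \<ge> 3"
  shows "allows (pattern_A3 (m + 2)) (HH (m + 2))"
proof -
  define d where "d k = (if k = m then 1 else - 2 * real k)" for k
  show ?thesis
  proof (rule allows_HH_if_arrow[where r = "\<lambda>i. - 2 * real i - 1" and d = d])
    show "inj_on d {..m}" by (auto simp: inj_on_def d_def)
  next
    fix i k :: nat
    have "- 2 * int i - 1 \<noteq> - 2 * int k" by presburger
    then have "real_of_int (- 2 * int i - 1) \<noteq> real_of_int (- 2 * int k)" by linarith
    then show "- 2 * real i - 1 \<noteq> d k" by (simp add: d_def)
  next
    fix \<sigma> :: real assume "\<bar>\<sigma>\<bar> \<le> 1"
    then have "- 1 \<le> \<sigma>" "\<sigma> \<le> 1" by linarith+
    moreover have "real m \<ge> 3" using assms by simp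
    moreover have "(\<Sum>i<m. - 2 * real i - 1) = - (real m * real m)"
      using sum_even_numbers[of m] by (simp add: sum_subtractf sum_negf)
    moreover have "(\<Sum>k\<le>m. d k) = 1 + real m - real m * real m"
      using sum_even_numbers[of m]
      by (simp add: d_def lessThan_Suc_atMost[symmetric] sum_negf)
    ultimately show "pattern_A3 (m + 2) $$ (0, 0) =
        sign_of ((\<Sum>i<m. - 2 * real i - 1) + 2 * \<sigma> - (\<Sum>k\<le>m. d k))"
      by (simp add: pattern_A3_def sign_pattern_def sign_of_def)
  next
    fix k assume k: "k \<le> m"
    have 1: "{i \<in> {..<m}. d k < - 2 * real i - 1} = (if k = m then {} else {..<k})"
      using k by (auto simp: d_def)
    have 2: "{l \<in> {..m}. d k < d l} = (if k = m then {} else insert m {..<k})"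
      using k by (auto simp: d_def)
    show "pattern_A3 (m + 2) $$ (Suc k, 0) =
        (if even (card {i \<in> {..<m}. d k < - 2 * real i - 1} + card {l \<in> {..m}. d k < d l})
         then Neg else Pos)"
      unfolding 1 2 using k by (auto simp: pattern_A3_def sign_pattern_def)
  qed (use assms in \<open>auto simp: pattern_A3_def sign_pattern_def sign_of_def inj_on_def d_def\<close>)
qed

theorem theorem2p2:
  fixes n :: nat and A :: "sign mat"
  assumes "n \<ge> 5"
    and "A \<in> {pattern_A1 n, pattern_A2 n, pattern_A3 n}"
  shows "allows A (HH n)"
proof -
  have "n = (n - 2) + 2" "n - 2 \<ge> 3" using assms(1) by auto
  then show ?thesis using assms(2) allows_A1 allows_A2 allows_A3 by (metis empty_iff insert_iff)
qed

end
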